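(* Let $K$ be a field and let $b,c\in K$ with $c\ne 1$. Assume that $Q_n(b,c)\neq 0$ for all $n\in\mathbb{N}$. Then $b$ and $c$ determine a unique graded twisting map; that is, there exists a unique graded twisting map $\tau:K[y]\otimes K[x]\to K[x]\otimes K[y]$ such that $$\tau(y\otimes x)=x^2\otimes 1+b\,x\otimes y+c\,(1\otimes y^2).$$
   Context: $\mathbb{N}=\{1,2,\dots\}$. The polynomials $P_n,Q_n$ in two variables $b,c$ are defined by $P_1=Q_1=1$ and $P_{n+1}=bP_n+Q_n$, $Q_{n+1}=Q_n-cP_n$. Tensor products are over $K$; $\mu_{K[x]},\mu_{K[y]}$ denote multiplication. A twisting map is a $K$-linear map $\tau:K[y]\otimes K[x]\to K[x]\otimes K[y]$ such that $\tau(1\otimes f)=f\otimes 1$ and $\tau(y^r\otimes 1)=1\otimes y^r$ for all $f\in K[x]$, $r\ge 0$; $\tau\circ(\mathrm{id}_{K[y]}\otimes\mu_{K[x]})=(\mu_{K[x]}\otimes \mathrm{id}_{K[y]})\circ(\mathrm{id}_{K[x]}\otimes\tau)\circ(\tau\otimes \mathrm{id}_{K[x]})$; and $\tau\circ(\mu_{K[y]}\otimes\mathrm{id}_{K[x]})=(\mathrm{id}_{K[x]}\otimes\mu_{K[y]})\circ(\tau\otimes\mathrm{id}_{K[y]})\circ(\mathrm{id}_{K[y]}\otimes\tau)$. It is graded if $\tau(y^r\otimes x^i)$ lies in the span of $\{x^{r+i-j}\otimes y^j:0\le j\le r+i\}$ for all $r,i$. *)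

theory Defs
  imports Complex_Main "HOL-Library.Poly_Mapping" "HOL-Computational_Algebra.Polynomial"
begin

section \<open>Free vector spaces and their tensor products\<close>

text \<open>
  The vector space over \<open>'k\<close> with basis \<open>'i\<close> is \<open>'i \<Rightarrow>\<^sub>0 'k\<close>, and the tensor product of the spaces
  with bases \<open>'i\<close> and \<open>'j\<close> is realised on the space with basis \<open>'i \<times> 'j\<close>; the pair \<open>(i, j)\<close>
  stands for \<open>e\<^sub>i \<otimes> e\<^sub>j\<close>. Its universal property is \<open>tensor_universal\<close> below.
\<close>

definition scale :: "'k::field \<Rightarrow> ('i \<Rightarrow>\<^sub>0 'k) \<Rightarrow> ('i \<Rightarrow>\<^sub>0 'k)" (infixr \<open>\<bullet>\<close> 75)
  where "a \<bullet> u = Poly_Mapping.map ((*) a) u"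

abbreviation klinear :: "(('i \<Rightarrow>\<^sub>0 'k::field) \<Rightarrow> ('j \<Rightarrow>\<^sub>0 'k)) \<Rightarrow> bool"
  where "klinear \<equiv> Vector_Spaces.linear scale scale"

definition kbilinear :: "(('i \<Rightarrow>\<^sub>0 'k::field) \<Rightarrow> ('j \<Rightarrow>\<^sub>0 'k) \<Rightarrow> ('l \<Rightarrow>\<^sub>0 'k)) \<Rightarrow> bool"
  where "kbilinear B \<longleftrightarrow> (\<forall>u. klinear (B u)) \<and> (\<forall>v. klinear (\<lambda>u. B u v))"

definition tensor :: "('i \<Rightarrow>\<^sub>0 'k::field) \<Rightarrow> ('j \<Rightarrow>\<^sub>0 'k) \<Rightarrow> ('i \<times> 'j \<Rightarrow>\<^sub>0 'k)" (infixr \<open>\<otimes>\<close> 72)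
  where "u \<otimes> v = (\<Sum>i\<in>Poly_Mapping.keys u. \<Sum>j\<in>Poly_Mapping.keys v.
           Poly_Mapping.single (i, j) (Poly_Mapping.lookup u i * Poly_Mapping.lookup v j))"

text \<open>For bilinear \<open>B\<close>, the linear map on the tensor product with \<open>u \<otimes> v \<mapsto> B u v\<close>.\<close>

definition tensor_lift ::
    "(('i \<Rightarrow>\<^sub>0 'k::field) \<Rightarrow> ('j \<Rightarrow>\<^sub>0 'k) \<Rightarrow> ('l \<Rightarrow>\<^sub>0 'k)) \<Rightarrow> ('i \<times> 'j \<Rightarrow>\<^sub>0 'k) \<Rightarrow> ('l \<Rightarrow>\<^sub>0 'k)"
  where "tensor_lift B t = (\<Sum>(i, j)\<in>Poly_Mapping.keys t.
           Poly_Mapping.lookup t (i, j) \<bullet> B (Poly_Mapping.single i 1) (Poly_Mapping.single j 1))"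

definition tensor_map ::
    "(('i \<Rightarrow>\<^sub>0 'k::field) \<Rightarrow> ('i' \<Rightarrow>\<^sub>0 'k)) \<Rightarrow> (('j \<Rightarrow>\<^sub>0 'k) \<Rightarrow> ('j' \<Rightarrow>\<^sub>0 'k)) \<Rightarrow>
     ('i \<times> 'j \<Rightarrow>\<^sub>0 'k) \<Rightarrow> ('i' \<times> 'j' \<Rightarrow>\<^sub>0 'k)" (infixr \<open>\<otimes>\<^sub>m\<close> 72)
  where "f \<otimes>\<^sub>m g = tensor_lift (\<lambda>u v. f u \<otimes> g v)"

text \<open>The canonical isomorphisms \<open>(U \<otimes> V) \<otimes> W \<rightarrow> U \<otimes> (V \<otimes> W)\<close> and back.\<close>

definition assoc_r :: "(('i \<times> 'j) \<times> 'l \<Rightarrow>\<^sub>0 'k::field) \<Rightarrow> ('i \<times> 'j \<times> 'l \<Rightarrow>\<^sub>0 'k)"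
  where "assoc_r = tensor_lift (\<lambda>t w. tensor_lift (\<lambda>u v. u \<otimes> v \<otimes> w) t)"

definition assoc_l :: "('i \<times> 'j \<times> 'l \<Rightarrow>\<^sub>0 'k::field) \<Rightarrow> (('i \<times> 'j) \<times> 'l \<Rightarrow>\<^sub>0 'k)"
  where "assoc_l = tensor_lift (\<lambda>u. tensor_lift (\<lambda>v w. (u \<otimes> v) \<otimes> w))"

lemma lookup_scale [simp]: "Poly_Mapping.lookup (a \<bullet> u) i = a * Poly_Mapping.lookup u i"
  by (simp add: scale_def map.rep_eq when_def)

lemma vector_space_scale: "vector_space scale"
  by standard (auto intro!: poly_mapping_eqI simp: lookup_add algebra_simps)

interpretation scale: vector_space scale
  by (rule vector_space_scale)

lemma klinearI:
  assumes "\<And>u v. f (u + v) = f u + f v" and "\<And>a u. f (a \<bullet> u) = a \<bullet> f u"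
  shows "klinear f"
  using assms by (simp add: Vector_Spaces.linear_iff vector_space_scale)

lemma klinear_add: "klinear f \<Longrightarrow> f (u + v) = f u + f v"
  by (simp add: Vector_Spaces.linear_iff)

lemma klinear_scale: "klinear f \<Longrightarrow> f (a \<bullet> u) = a \<bullet> f u"
  by (simp add: Vector_Spaces.linear_iff)

lemma klinear_zero: "klinear f \<Longrightarrow> f 0 = 0"
  by (metis add_cancel_right_right klinear_add)

lemma klinear_sum: "klinear f \<Longrightarrow> f (sum g A) = (\<Sum>x\<in>A. f (g x))"
  by (induction A rule: infinite_finite_induct) (simp_all add: klinear_zero klinear_add)

lemma basis_expansion:
  fixes u :: "'i \<Rightarrow>\<^sub>0 'k::field"
  assumes "finite A" "Poly_Mapping.keys u \<subseteq> A"
  shows "u = (\<Sum>i\<in>A. Poly_Mapping.lookup u i \<bullet> Poly_Mapping.single i 1)"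
proof (rule poly_mapping_eqI)
  fix m
  have "(\<Sum>i\<in>A. Poly_Mapping.lookup u i * (1 when i = m)) = Poly_Mapping.lookup u m"
  proof (cases "m \<in> A")
    case True
    then show ?thesis
      using assms(1) by (simp add: when_def if_distrib[of "\<lambda>x. _ * x"] sum.delta cong: if_cong)
  next
    case False
    then have "Poly_Mapping.lookup u m = 0"
      using assms(2) by (auto simp: in_keys_iff)
    moreover have "(\<Sum>i\<in>A. Poly_Mapping.lookup u i * (1 when i = m)) = 0"
      using False by (intro sum.neutral) (auto simp: when_def)
    ultimately show ?thesis by simp
  qed
  then show "Poly_Mapping.lookup u m =
      Poly_Mapping.lookup (\<Sum>i\<in>A. Poly_Mapping.lookup u i \<bullet> Poly_Mapping.single i 1) m"
    by (simp add: lookup_sum lookup_single)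
qed

lemma lookup_tensor [simp]:
  "Poly_Mapping.lookup (u \<otimes> v) (i, j) = Poly_Mapping.lookup u i * Poly_Mapping.lookup v j"
proof -
  have "Poly_Mapping.lookup (u \<otimes> v) (i, j) =
      (\<Sum>i'\<in>Poly_Mapping.keys u. \<Sum>j'\<in>Poly_Mapping.keys v.
        if j' = j then if i' = i then Poly_Mapping.lookup u i' * Poly_Mapping.lookup v j' else 0 else 0)"
    unfolding tensor_def lookup_sum
    by (intro sum.cong refl) (auto simp: lookup_single when_def)
  also have "\<dots> = Poly_Mapping.lookup u i * Poly_Mapping.lookup v j"
    by (cases "Poly_Mapping.lookup v j = 0") (auto simp: sum.delta in_keys_iff)
  finally show ?thesis .
qed

lemma tensor_single:
  "Poly_Mapping.single i a \<otimes> Poly_Mapping.single j b = Poly_Mapping.single (i, j) (a * b)"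
proof (rule poly_mapping_eqI)
  fix p
  show "Poly_Mapping.lookup (Poly_Mapping.single i a \<otimes> Poly_Mapping.single j b) p =
      Poly_Mapping.lookup (Poly_Mapping.single (i, j) (a * b)) p"
    by (cases p) (auto simp: lookup_single when_def)
qed

lemma tensor_eqI:
  assumes "\<And>i j. Poly_Mapping.lookup s (i, j) = Poly_Mapping.lookup t (i, j)"
  shows "s = t"
  using assms by (auto intro: poly_mapping_eqI)

lemma kbilinear_tensor: "kbilinear (\<otimes>)"
  unfolding kbilinear_def
  by (auto intro!: klinearI tensor_eqI simp: lookup_add algebra_simps)

lemma tensor_lift_superset:
  assumes "finite A" "Poly_Mapping.keys t \<subseteq> A"
  shows "tensor_lift B t = (\<Sum>(i, j)\<in>A.
    Poly_Mapping.lookup t (i, j) \<bullet> B (Poly_Mapping.single i 1) (Poly_Mapping.single j 1))"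
  unfolding tensor_lift_def using assms
  by (intro sum.mono_neutral_left) (auto simp: in_keys_iff)

lemma klinear_tensor_lift:
  fixes B :: "('i \<Rightarrow>\<^sub>0 'k::field) \<Rightarrow> ('j \<Rightarrow>\<^sub>0 'k) \<Rightarrow> ('l \<Rightarrow>\<^sub>0 'k)"
  shows "klinear (tensor_lift B)"
proof (rule klinearI)
  fix s t :: "'i \<times> 'j \<Rightarrow>\<^sub>0 'k" and a
  let ?A = "Poly_Mapping.keys s \<union> Poly_Mapping.keys t"
  have *: "finite ?A" "Poly_Mapping.keys s \<subseteq> ?A" "Poly_Mapping.keys t \<subseteq> ?A"
    "Poly_Mapping.keys (s + t) \<subseteq> ?A"
    using Poly_Mapping.keys_add[of s t] by auto
  show "tensor_lift B (s + t) = tensor_lift B s + tensor_lift B t"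
    unfolding tensor_lift_superset[OF *(1,2)] tensor_lift_superset[OF *(1,3)]
      tensor_lift_superset[OF *(1,4)]
    by (simp add: lookup_add scale.scale_left_distrib sum.distrib case_prod_unfold)
  have "Poly_Mapping.keys (a \<bullet> t) \<subseteq> Poly_Mapping.keys t"
    by (auto simp: in_keys_iff)
  from tensor_lift_superset[OF _ this]
  show "tensor_lift B (a \<bullet> t) = a \<bullet> tensor_lift B t"
    by (simp add: tensor_lift_def scale.scale_sum_right case_prod_unfold)
qed

lemma tensor_lift_single:
  "tensor_lift B (Poly_Mapping.single (i, j) 1) = B (Poly_Mapping.single i 1) (Poly_Mapping.single j 1)"
  unfolding tensor_lift_def by simp

lemma klinear_eqI:
  assumes "klinear f" "klinear g" "\<And>i. f (Poly_Mapping.single i 1) = g (Poly_Mapping.single i 1)"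
  shows "f = g"
proof
  fix u
  show "f u = g u"
    by (subst (1 2) basis_expansion[OF finite_keys subset_refl, of u])
      (simp add: assms klinear_sum klinear_scale)
qed

lemma klinear_compose: "klinear f \<Longrightarrow> klinear g \<Longrightarrow> klinear (\<lambda>x. f (g x))"
  by (intro klinearI) (simp_all add: klinear_add klinear_scale)

lemma tensor_lift_tensor:
  assumes "kbilinear B"
  shows "tensor_lift B (u \<otimes> v) = B u v"
proof -
  have B: "klinear (B u)" "klinear (\<lambda>u. B u v)" for u v
    using assms by (auto simp: kbilinear_def)
  have T: "klinear (\<lambda>v. tensor_lift B (u \<otimes> v))" "klinear (\<lambda>u. tensor_lift B (u \<otimes> v))" for u v
    using kbilinear_tensor unfolding kbilinear_def
    by (auto intro: klinear_compose[OF klinear_tensor_lift])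
  have "(\<lambda>v. tensor_lift B (Poly_Mapping.single i 1 \<otimes> v)) = B (Poly_Mapping.single i 1)" for i
    by (rule klinear_eqI[OF T(1) B(1)]) (simp add: tensor_single tensor_lift_single)
  then have "(\<lambda>u. tensor_lift B (u \<otimes> v)) = (\<lambda>u. B u v)"
    by (intro klinear_eqI[OF T(2) B(2)]) metis
  then show ?thesis by metis
qed

lemma tensor_universal:
  fixes B :: "('i \<Rightarrow>\<^sub>0 'k::field) \<Rightarrow> ('j \<Rightarrow>\<^sub>0 'k) \<Rightarrow> ('l \<Rightarrow>\<^sub>0 'k)"
  assumes "kbilinear B"
  shows "\<exists>!f. klinear f \<and> (\<forall>u v. f (u \<otimes> v) = B u v)"
proof (rule ex1I[of _ "tensor_lift B"])
  show "klinear (tensor_lift B) \<and> (\<forall>u v. tensor_lift B (u \<otimes> v) = B u v)"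
    using assms by (simp add: klinear_tensor_lift tensor_lift_tensor)
next
  fix f :: "('i \<times> 'j \<Rightarrow>\<^sub>0 'k) \<Rightarrow> ('l \<Rightarrow>\<^sub>0 'k)"
  assume f: "klinear f \<and> (\<forall>u v. f (u \<otimes> v) = B u v)"
  show "f = tensor_lift B"
  proof (rule klinear_eqI)
    fix p :: "'i \<times> 'j"
    obtain i j where p: "p = (i, j)" by (cases p)
    from f have "f (Poly_Mapping.single i 1 \<otimes> Poly_Mapping.single j 1) =
        B (Poly_Mapping.single i 1) (Poly_Mapping.single j 1)"
      by blast
    then show "f (Poly_Mapping.single p 1) = tensor_lift B (Poly_Mapping.single p 1)"
      by (simp add: p tensor_single tensor_lift_single)
  qed (use f klinear_tensor_lift in auto)
qed

lemma tensor_map_tensor: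
  assumes "klinear f" "klinear g"
  shows "(f \<otimes>\<^sub>m g) (u \<otimes> v) = f u \<otimes> g v"
  unfolding tensor_map_def using assms
  by (intro tensor_lift_tensor)
    (auto simp: kbilinear_def klinear_add klinear_scale lookup_add algebra_simps
      intro!: klinearI tensor_eqI)

lemma assoc_r_tensor:
  fixes u :: "'i \<Rightarrow>\<^sub>0 'k::field" and v :: "'j \<Rightarrow>\<^sub>0 'k" and w :: "'l \<Rightarrow>\<^sub>0 'k"
  shows "assoc_r ((u \<otimes> v) \<otimes> w) = u \<otimes> v \<otimes> w"
proof -
  have B: "kbilinear (\<lambda>(u::'i \<Rightarrow>\<^sub>0 'k) (v::'j \<Rightarrow>\<^sub>0 'k). u \<otimes> v \<otimes> w)" for w :: "'l \<Rightarrow>\<^sub>0 'k"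
    by (auto simp: kbilinear_def lookup_add algebra_simps intro!: klinearI tensor_eqI)
  have "klinear (\<lambda>w::'l \<Rightarrow>\<^sub>0 'k. tensor_lift (\<lambda>u v. u \<otimes> v \<otimes> w) t)" for t :: "'i \<times> 'j \<Rightarrow>\<^sub>0 'k"
    by (auto simp: tensor_lift_def lookup_sum lookup_add sum.distrib sum_distrib_left algebra_simps
      case_prod_unfold intro!: klinearI tensor_eqI)
  then have "kbilinear (\<lambda>(t::'i \<times> 'j \<Rightarrow>\<^sub>0 'k) (w::'l \<Rightarrow>\<^sub>0 'k). tensor_lift (\<lambda>u v. u \<otimes> v \<otimes> w) t)"
    unfolding kbilinear_def by (blast intro: klinear_tensor_lift)
  then show ?thesis
    by (simp add: assoc_r_def tensor_lift_tensor B)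
qed

lemma assoc_l_tensor:
  fixes u :: "'i \<Rightarrow>\<^sub>0 'k::field" and v :: "'j \<Rightarrow>\<^sub>0 'k" and w :: "'l \<Rightarrow>\<^sub>0 'k"
  shows "assoc_l (u \<otimes> v \<otimes> w) = (u \<otimes> v) \<otimes> w"
proof -
  have B: "kbilinear (\<lambda>(v::'j \<Rightarrow>\<^sub>0 'k) (w::'l \<Rightarrow>\<^sub>0 'k). (u \<otimes> v) \<otimes> w)" for u :: "'i \<Rightarrow>\<^sub>0 'k"
    by (auto simp: kbilinear_def lookup_add algebra_simps intro!: klinearI tensor_eqI)
  have "klinear (\<lambda>u::'i \<Rightarrow>\<^sub>0 'k. tensor_lift (\<lambda>v w. (u \<otimes> v) \<otimes> w) t)" for t :: "'j \<times> 'l \<Rightarrow>\<^sub>0 'k"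
    by (auto simp: tensor_lift_def lookup_sum lookup_add sum.distrib sum_distrib_left algebra_simps
      case_prod_unfold intro!: klinearI tensor_eqI)
  then have "kbilinear (\<lambda>u::'i \<Rightarrow>\<^sub>0 'k. tensor_lift (\<lambda>(v::'j \<Rightarrow>\<^sub>0 'k) (w::'l \<Rightarrow>\<^sub>0 'k). (u \<otimes> v) \<otimes> w))"
    unfolding kbilinear_def by (blast intro: klinear_tensor_lift)
  then show ?thesis
    by (simp add: assoc_l_def tensor_lift_tensor B)
qed


section \<open>Polynomial rings\<close>

text \<open>
  Both \<open>K[x]\<close> and \<open>K[y]\<close> are the convolution algebra \<open>nat \<Rightarrow>\<^sub>0 'k\<close>, identified with \<open>'k poly\<close>
  by \<open>to_poly\<close> below; the two names \<open>X\<close> and \<open>Y\<close> for the indeterminate only serve readability.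
\<close>

type_synonym 'k upoly = "nat \<Rightarrow>\<^sub>0 'k"

definition X :: "'k::field upoly" where "X = Poly_Mapping.single 1 1"

definition Y :: "'k::field upoly" where "Y = Poly_Mapping.single 1 1"

definition mu :: "(nat \<times> nat \<Rightarrow>\<^sub>0 'k::field) \<Rightarrow> 'k upoly"
  where "mu = tensor_lift (*)"

definition to_poly :: "'k::field upoly \<Rightarrow> 'k poly"
  where "to_poly p = Abs_poly (Poly_Mapping.lookup p)"

lemma coeff_to_poly [simp]: "coeff (to_poly p) n = Poly_Mapping.lookup p n"
proof -
  have "\<forall>\<^sub>\<infinity>n. Poly_Mapping.lookup p n = 0"
    using finite_lookup[of p] by (simp add: eventually_cofinite)
  then show ?thesis by (simp add: to_poly_def Abs_poly_inverse)
qed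

lemma bij_to_poly: "bij (to_poly :: 'k::field upoly \<Rightarrow> 'k poly)"
proof (rule bijI)
  show "inj (to_poly :: 'k upoly \<Rightarrow> 'k poly)"
    by (rule injI, rule poly_mapping_eqI) (metis coeff_to_poly)
  show "surj (to_poly :: 'k upoly \<Rightarrow> 'k poly)"
  proof (rule surjI[where f = "\<lambda>q. Abs_poly_mapping (coeff q)"])
    fix q :: "'k poly"
    have "finite {n. coeff q n \<noteq> 0}"
      using MOST_coeff_eq_0[of q] by (simp add: eventually_cofinite)
    then show "to_poly (Abs_poly_mapping (coeff q)) = q"
      by (intro poly_eqI) simp
  qed
qed

lemma to_poly_add: "to_poly (p + q) = to_poly p + to_poly q"
  by (intro poly_eqI) (simp add: lookup_add)

lemma to_poly_scale: "to_poly (a \<bullet> p) = smult a (to_poly p)"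
  by (intro poly_eqI) simp

lemma to_poly_mult:
  fixes p q :: "'a::field upoly"
  shows "to_poly (p * q) = to_poly p * to_poly q"
proof -
  have 1: "to_poly (sum f A) = (\<Sum>a\<in>A. to_poly (f a))" for f :: "'b \<Rightarrow> 'a upoly" and A
    by (intro poly_eqI) (simp add: lookup_sum coeff_sum)
  have single: "to_poly (Poly_Mapping.single n a) = monom a n" for n and a :: 'a
    by (intro poly_eqI) (simp add: lookup_single when_def)
  have exp: "p = (\<Sum>i\<in>Poly_Mapping.keys p. Poly_Mapping.single i (Poly_Mapping.lookup p i))"
    for p :: "'a upoly"
    by (subst (1) basis_expansion[OF finite_keys subset_refl, of p], rule sum.cong)
      (auto intro!: poly_mapping_eqI simp: lookup_single when_def)
  show ?thesis
    by (subst (1 2) exp[of p], subst (1 2) exp[of q])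
      (simp add: sum_product 1 single mult_single mult_monom)
qed

lemma to_poly_1: "to_poly 1 = 1"
  by (intro poly_eqI) (simp add: lookup_one when_def coeff_1)

lemma to_poly_X: "to_poly X = [:0, 1:]"
  by (intro poly_eqI) (auto simp: X_def lookup_single when_def coeff_pCons split: nat.split)

lemma mu_tensor:
  fixes p q :: "'a::field upoly"
  shows "mu (p \<otimes> q) = p * q"
proof -
  have "p * (a \<bullet> q) = a \<bullet> (p * q)" "(a \<bullet> p) * q = a \<bullet> (p * q)" for a and p q :: "'a upoly"
    by (rule injD[OF bij_is_inj[OF bij_to_poly]], simp add: to_poly_mult to_poly_scale)+
  then have "kbilinear ((*) :: 'a upoly \<Rightarrow> _)"
    by (auto simp: kbilinear_def algebra_simps intro!: klinearI)
  then show ?thesis by (simp add: mu_def tensor_lift_tensor)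
qed


section \<open>Twisting maps\<close>

text \<open>
  The argument of \<open>\<tau>\<close> is read in \<open>K[y] \<otimes> K[x]\<close>, its value in \<open>K[x] \<otimes> K[y]\<close>.
  The last two equations are maps on \<open>K[y] \<otimes> (K[x] \<otimes> K[x])\<close> and \<open>(K[y] \<otimes> K[y]) \<otimes> K[x]\<close>.
\<close>

definition twisting_map :: "((nat \<times> nat \<Rightarrow>\<^sub>0 'k::field) \<Rightarrow> (nat \<times> nat \<Rightarrow>\<^sub>0 'k)) \<Rightarrow> bool"
  where "twisting_map \<tau> \<longleftrightarrow>
    klinear \<tau> \<and>
    (\<forall>f. \<tau> (1 \<otimes> f) = f \<otimes> 1) \<and>
    (\<forall>r. \<tau> (Y ^ r \<otimes> 1) = 1 \<otimes> Y ^ r) \<and>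
    \<tau> \<circ> (id \<otimes>\<^sub>m mu) = (mu \<otimes>\<^sub>m id) \<circ> assoc_l \<circ> (id \<otimes>\<^sub>m \<tau>) \<circ> assoc_r \<circ> (\<tau> \<otimes>\<^sub>m id) \<circ> assoc_l \<and>
    \<tau> \<circ> (mu \<otimes>\<^sub>m id) = (id \<otimes>\<^sub>m mu) \<circ> assoc_r \<circ> (\<tau> \<otimes>\<^sub>m id) \<circ> assoc_l \<circ> (id \<otimes>\<^sub>m \<tau>) \<circ> assoc_r"

definition graded_map :: "((nat \<times> nat \<Rightarrow>\<^sub>0 'k::field) \<Rightarrow> (nat \<times> nat \<Rightarrow>\<^sub>0 'k)) \<Rightarrow> bool"
  where "graded_map \<tau> \<longleftrightarrow>
    (\<forall>r i. \<tau> (Y ^ r \<otimes> X ^ i) \<in> module.span scale {X ^ (r + i - j) \<otimes> Y ^ j | j. j \<le> r + i})"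


section \<open>The polynomials P and Q\<close>

text \<open>
  Evaluated at elements \<open>b, c\<close> of a commutative ring. The recursion is started at 0, where
  \<open>P\<^sub>0 = 0\<close> and \<open>Q\<^sub>0 = 1\<close> yield \<open>P\<^sub>1 = Q\<^sub>1 = 1\<close>.
\<close>

fun P :: "nat \<Rightarrow> 'a::comm_ring_1 \<Rightarrow> 'a \<Rightarrow> 'a" and Q :: "nat \<Rightarrow> 'a::comm_ring_1 \<Rightarrow> 'a \<Rightarrow> 'a" where
  "P 0 b c = 0"
| "Q 0 b c = 1"
| "P (Suc n) b c = b * P n b c + Q n b c"
| "Q (Suc n) b c = Q n b c - c * P n b c"

lemma P_1_Q_1: "P 1 b c = 1" "Q 1 b c = 1"
  by simp_all

end

theory Submission
  imports Defs
begin

text \<open>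
  A graded map sends \<open>y\<^sup>r \<otimes> x\<^sup>i\<close> to a homogeneous element of degree \<open>r + i\<close>, and a homogeneous
  element of known degree can be recovered after setting \<open>x = 1\<close>. Let \<open>M\<close> be the linear operator
  on \<open>K[y]\<close> which takes \<open>y\<^sup>r\<close> to \<open>\<tau>(y\<^sup>r \<otimes> x)\<close> at \<open>x = 1\<close>. Compatibility of \<open>\<tau>\<close> with the
  multiplication of \<open>K[x]\<close> means precisely that \<open>\<tau>(y\<^sup>r \<otimes> x\<^sup>i)\<close> at \<open>x = 1\<close> is \<open>M\<^sup>i y\<^sup>r\<close>, so \<open>\<tau>\<close> is
  determined by the rows \<open>\<rho>\<^sub>r = M y\<^sup>r\<close>, which have degree at most \<open>r + 1\<close>
  (\<open>graded_twisting_eq_row_twist\<close>).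

  Compatibility with the multiplication of \<open>K[y]\<close>, applied to \<open>y\<^sup>s \<cdot> y\<close> and to \<open>x\<close>, turns the
  prescribed value of \<open>\<tau>(y \<otimes> x)\<close> into \<open>M(y u) = M(M u) + b y M u + c y\<^sup>2 u\<close>
  (\<open>graded_twisting_rows\<close>). At \<open>u = y\<^sup>s\<close> this is a recursion for the rows, except that
  \<open>\<rho>\<^sub>s\<^sub>+\<^sub>1\<close> also occurs on the right, inside \<open>M(M y\<^sup>s) = M \<rho>\<^sub>s\<close>, with the top coefficient \<open>m\<^sub>s\<close> of \<open>\<rho>\<^sub>s\<close>
  as factor. Comparing top coefficients gives \<open>(1 - m\<^sub>s) m\<^sub>s\<^sub>+\<^sub>1 = b m\<^sub>s + c\<close>, hence
  \<open>m\<^sub>s = c P\<^sub>s / Q\<^sub>s\<close> and \<open>1 - m\<^sub>s = Q\<^sub>s\<^sub>+\<^sub>1 / Q\<^sub>s\<close>. As no \<open>Q\<^sub>s\<close> vanishes, \<open>\<rho>\<^sub>s\<^sub>+\<^sub>1\<close> can be isolated, and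
  exactly one sequence of rows exists (\<open>twist_rows_iff\<close>).

  It remains to see that the map built from this sequence is compatible with the multiplication
  of \<open>K[y]\<close> in all degrees, not only for \<open>y\<^sup>s \<cdot> y\<close> and \<open>x\<close>. On \<open>K[y]\<close> this says that
  \<open>M\<^sup>k (y\<^sup>s u)\<close> is the sum over \<open>l\<close> of \<open>y\<^sup>l M\<^sup>s\<^sup>+\<^sup>k\<^sup>-\<^sup>l u\<close>, weighted with the coefficients of
  \<open>M\<^sup>k y\<^sup>s\<close>. For \<open>k = 1\<close> it follows by induction on \<open>s\<close> from the relation for \<open>M\<close>,
  dividing once more by \<open>1 - m\<^sub>s\<close> (\<open>twist_mult_bvec\<close>); the general case is an iteration.
\<close>

section \<open>Linear extension from a basis\<close>

abbreviation bvec :: "'i \<Rightarrow> ('i \<Rightarrow>\<^sub>0 'k::field)"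
  where "bvec i \<equiv> Poly_Mapping.single i 1"

definition lin_ext :: "('i \<Rightarrow> ('j \<Rightarrow>\<^sub>0 'k::field)) \<Rightarrow> ('i \<Rightarrow>\<^sub>0 'k) \<Rightarrow> ('j \<Rightarrow>\<^sub>0 'k)"
  where "lin_ext g u = (\<Sum>i\<in>Poly_Mapping.keys u. Poly_Mapping.lookup u i \<bullet> g i)"

lemma lin_ext_superset:
  assumes "finite A" "Poly_Mapping.keys u \<subseteq> A"
  shows "lin_ext g u = (\<Sum>i\<in>A. Poly_Mapping.lookup u i \<bullet> g i)"
  unfolding lin_ext_def using assms
  by (intro sum.mono_neutral_left) (auto simp: in_keys_iff)

lemma klinear_lin_ext [simp]:
  fixes g :: "'i \<Rightarrow> ('j \<Rightarrow>\<^sub>0 'k::field)"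
  shows "klinear (lin_ext g)"
proof (rule klinearI)
  fix s t :: "'i \<Rightarrow>\<^sub>0 'k" and a
  let ?A = "Poly_Mapping.keys s \<union> Poly_Mapping.keys t"
  have *: "finite ?A" "Poly_Mapping.keys s \<subseteq> ?A" "Poly_Mapping.keys t \<subseteq> ?A"
    "Poly_Mapping.keys (s + t) \<subseteq> ?A"
    using Poly_Mapping.keys_add[of s t] by auto
  show "lin_ext g (s + t) = lin_ext g s + lin_ext g t"
    unfolding lin_ext_superset[OF *(1,2)] lin_ext_superset[OF *(1,3)] lin_ext_superset[OF *(1,4)]
    by (simp add: lookup_add scale.scale_left_distrib sum.distrib)
  have "Poly_Mapping.keys (a \<bullet> t) \<subseteq> Poly_Mapping.keys t"
    by (auto simp: in_keys_iff)
  from lin_ext_superset[OF _ this] show "lin_ext g (a \<bullet> t) = a \<bullet> lin_ext g t"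
    by (simp add: lin_ext_def scale.scale_sum_right)
qed

lemma lin_ext_bvec [simp]: "lin_ext g (bvec i) = g i"
  by (simp add: lin_ext_def)

lemma lin_ext_add [simp]: "lin_ext g (u + v) = lin_ext g u + lin_ext g v"
  by (simp add: klinear_add)

lemma lin_ext_scale [simp]: "lin_ext g (a \<bullet> u) = a \<bullet> lin_ext g u"
  by (simp add: klinear_scale)

lemma klinear_eq_lin_ext: "klinear f \<Longrightarrow> f u = lin_ext (\<lambda>i. f (bvec i)) u"
  by (rule fun_cong[of f], rule klinear_eqI) simp_all

lemma klinear_of_lin_ext: "klinear f \<Longrightarrow> f (lin_ext g u) = lin_ext (\<lambda>i. f (g i)) u"
  by (simp add: lin_ext_def klinear_sum klinear_scale)

lemma lin_ext_cong:
  "(\<And>i. i \<in> Poly_Mapping.keys u \<Longrightarrow> g i = h i) \<Longrightarrow> lin_ext g u = lin_ext h u"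
  by (simp add: lin_ext_def)

lemma keys_scale: "Poly_Mapping.keys (a \<bullet> u) \<subseteq> Poly_Mapping.keys u"
  by (auto simp: in_keys_iff)

lemma keys_lin_ext:
  assumes "\<And>i. i \<in> Poly_Mapping.keys u \<Longrightarrow> Poly_Mapping.keys (g i) \<subseteq> A"
  shows "Poly_Mapping.keys (lin_ext g u) \<subseteq> A"
proof
  fix k assume "k \<in> Poly_Mapping.keys (lin_ext g u)"
  then have "(\<Sum>i\<in>Poly_Mapping.keys u. Poly_Mapping.lookup u i * Poly_Mapping.lookup (g i) k) \<noteq> 0"
    by (simp add: lin_ext_def in_keys_iff lookup_sum)
  then obtain i where "i \<in> Poly_Mapping.keys u" "Poly_Mapping.lookup (g i) k \<noteq> 0"
    by (rule sum.not_neutral_contains_not_neutral) auto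
  then show "k \<in> A" using assms[of i] by (auto simp: in_keys_iff)
qed

section \<open>Multiplication by powers of the indeterminate\<close>

lemma X_power: "X ^ n = bvec n" and Y_power: "Y ^ n = bvec n"
  by (induction n) (simp_all add: X_def Y_def mult_single)

lemma scale_mult_right: "p * (a \<bullet> q) = a \<bullet> (p * q :: 'k::field upoly)"
  by (rule injD[OF bij_is_inj[OF bij_to_poly]]) (simp add: to_poly_mult to_poly_scale)

lemma klinear_mult [simp]: "klinear ((*) (p :: 'k::field upoly))"
  by (rule klinearI) (simp_all add: algebra_simps scale_mult_right)

lemma Y_mult_bvec: "Y * bvec n = bvec (Suc n)"
  by (simp add: Y_def mult_single)

lemma bvec_mult_bvec: "bvec m * bvec n = (bvec (m + n) :: 'k::field upoly)"
  by (simp add: mult_single)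

lemma Y_mult_eq: "Y * u = lin_ext (\<lambda>n. bvec (Suc n)) (u :: 'k::field upoly)"
  using klinear_eq_lin_ext[of "(*) Y" u] by (simp add: Y_mult_bvec)

lemma lookup_Y_mult_Suc: "Poly_Mapping.lookup (Y * u) (Suc n) = Poly_Mapping.lookup u n"
proof -
  have "to_poly (Y :: 'a upoly) = [:0, 1:]"
    using to_poly_X by (simp add: X_def Y_def)
  then have "coeff (to_poly (Y * u)) (Suc n) = coeff (to_poly u) n"
    unfolding to_poly_mult by simp
  then show ?thesis by simp
qed

section \<open>The recursion for the rows\<close>

text \<open>
  The value \<open>\<rho> s\<close> plays the part of \<open>M y\<^sup>s\<close>, so that \<open>M\<close> is \<open>lin_ext \<rho>\<close>; the last equation is
  \<open>M(y u) = M(M u) + b y M u + c y\<^sup>2 u\<close> at \<open>u = y\<^sup>s\<close>.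
\<close>

definition twist_rows :: "'k::field \<Rightarrow> 'k \<Rightarrow> (nat \<Rightarrow> 'k upoly) \<Rightarrow> bool"
  where "twist_rows b c \<rho> \<longleftrightarrow> \<rho> 0 = 1 \<and> (\<forall>s. Poly_Mapping.keys (\<rho> s) \<subseteq> {..Suc s} \<and>
     \<rho> (Suc s) = lin_ext \<rho> (\<rho> s) + b \<bullet> (Y * \<rho> s) + c \<bullet> bvec (s + 2))"

lemma lin_ext_split_top:
  assumes "Poly_Mapping.keys u \<subseteq> {..Suc s}"
  shows "lin_ext \<rho> u = (\<Sum>j\<le>s. Poly_Mapping.lookup u j \<bullet> \<rho> j) + Poly_Mapping.lookup u (Suc s) \<bullet> \<rho> (Suc s)"
  using lin_ext_superset[OF _ assms, of \<rho>] by simp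

lemma lookup_eq_0: "Poly_Mapping.keys u \<subseteq> A \<Longrightarrow> i \<notin> A \<Longrightarrow> Poly_Mapping.lookup u i = 0"
  by (auto simp: in_keys_iff)

text \<open>
  The right-hand side of the recursion for \<open>\<rho> (Suc s)\<close> without its multiple of \<open>\<rho> (Suc s)\<close>:
  only rows up to \<open>s\<close> occur.
\<close>

definition lower_part :: "'k::field \<Rightarrow> 'k \<Rightarrow> (nat \<Rightarrow> 'k upoly) \<Rightarrow> nat \<Rightarrow> 'k upoly"
  where "lower_part b c \<rho> s = (\<Sum>j\<le>s. Poly_Mapping.lookup (\<rho> s) j \<bullet> \<rho> j) + b \<bullet> (Y * \<rho> s) + c \<bullet> bvec (s + 2)"

lemma lookup_lower_part:
  assumes "\<And>j. j \<le> s \<Longrightarrow> Poly_Mapping.keys (\<rho> j) \<subseteq> {..Suc j}"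
  shows "Poly_Mapping.lookup (lower_part b c \<rho> s) (Suc (Suc s)) = b * Poly_Mapping.lookup (\<rho> s) (Suc s) + c"
proof -
  have "Poly_Mapping.lookup (\<rho> j) (Suc (Suc s)) = 0" if "j \<le> s" for j
    by (rule lookup_eq_0[OF assms[OF that]]) (use that in auto)
  then show ?thesis
    by (simp add: lower_part_def lookup_add lookup_sum lookup_Y_mult_Suc)
qed

lemma keys_lower_part:
  assumes "\<And>j. j \<le> s \<Longrightarrow> Poly_Mapping.keys (\<rho> j) \<subseteq> {..Suc j}"
  shows "Poly_Mapping.keys (lower_part b c \<rho> s) \<subseteq> {..Suc (Suc s)}"
proof
  fix k assume k: "k \<in> Poly_Mapping.keys (lower_part b c \<rho> s)"
  show "k \<in> {..Suc (Suc s)}"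
  proof (rule ccontr)
    assume n: "k \<notin> {..Suc (Suc s)}"
    then obtain l where l: "k = Suc l" by (cases k) auto
    have "Poly_Mapping.lookup (\<rho> j) k = 0" if "j \<le> s" for j
      by (rule lookup_eq_0[OF assms[OF that]]) (use n that in auto)
    moreover have "Poly_Mapping.lookup (\<rho> s) l = 0"
      by (rule lookup_eq_0[OF assms[OF order_refl]]) (use n l in auto)
    ultimately have "Poly_Mapping.lookup (lower_part b c \<rho> s) k = 0"
      using n by (auto simp: lower_part_def lookup_add lookup_sum l lookup_Y_mult_Suc lookup_single when_def)
    then show False using k by (simp add: in_keys_iff)
  qed
qed

text \<open>
  The solved recursion: the factor is the inverse of \<open>1 - m\<^sub>s = Q\<^sub>s\<^sub>+\<^sub>1 / Q\<^sub>s\<close>, where \<open>m\<^sub>s\<close> is the top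
  coefficient of row \<open>s\<close>.
\<close>

fun row :: "'k::field \<Rightarrow> 'k \<Rightarrow> nat \<Rightarrow> 'k upoly"
  where
    "row b c 0 = 1"
  | "row b c (Suc s) = (Q s b c / Q (Suc s) b c) \<bullet>
       ((\<Sum>j\<le>s. Poly_Mapping.lookup (row b c s) j \<bullet> row b c j) + b \<bullet> (Y * row b c s) + c \<bullet> bvec (s + 2))"

lemma row_Suc: "row b c (Suc s) = (Q s b c / Q (Suc s) b c) \<bullet> lower_part b c (row b c) s"
  by (simp add: lower_part_def)

declare row.simps(2) [simp del]

lemma keys_row: "Poly_Mapping.keys (row b c s) \<subseteq> {..Suc s}"
proof (induction s rule: less_induct)
  case (less s)
  show ?case
  proof (cases s)
    case 0
    then show ?thesis by (simp)
  next
    case (Suc n)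
    have "Poly_Mapping.keys (lower_part b c (row b c) n) \<subseteq> {..Suc (Suc n)}"
      by (rule keys_lower_part) (use less Suc in auto)
    then show ?thesis
      unfolding Suc row_Suc by (rule subset_trans[OF keys_scale])
  qed
qed

text \<open>
  Top coefficients satisfy \<open>m\<^sub>s\<^sub>+\<^sub>1 = (Q\<^sub>s / Q\<^sub>s\<^sub>+\<^sub>1) (b m\<^sub>s + c)\<close>, and with \<open>m\<^sub>s = c P\<^sub>s / Q\<^sub>s\<close> the recursion
  for \<open>P\<close> appears in the numerator.
\<close>

lemma top_row:
  assumes "\<And>n. Q n b c \<noteq> 0"
  shows "Poly_Mapping.lookup (row b c s) (Suc s) = c * P s b c / Q s b c"
proof (induction s)
  case 0
  show ?case by (simp add: lookup_one)
next
  case (Suc s)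
  have "Poly_Mapping.lookup (row b c (Suc s)) (Suc (Suc s)) =
      Q s b c / Q (Suc s) b c * (b * (c * P s b c / Q s b c) + c)"
    unfolding row_Suc lookup_scale by (subst lookup_lower_part) (rule keys_row, simp only: Suc)
  also have "Q s b c / Q (Suc s) b c * (b * (c * P s b c / Q s b c) + c) =
      Q s b c * (b * (c * P s b c / Q s b c) + c) / Q (Suc s) b c"
    by simp
  also have "Q s b c * (b * (c * P s b c / Q s b c) + c) = c * (b * P s b c + Q s b c)"
    using assms[of s] by (simp add: algebra_simps)
  finally show ?case by simp
qed

text \<open>Collecting the two occurrences of \<open>\<rho> (Suc s)\<close> on one side.\<close>

lemma twist_rows_Suc:
  assumes "twist_rows b c \<rho>"
  shows "(1 - Poly_Mapping.lookup (\<rho> s) (Suc s)) \<bullet> \<rho> (Suc s) = lower_part b c \<rho> s"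
proof -
  have "\<rho> (Suc s) = lower_part b c \<rho> s + Poly_Mapping.lookup (\<rho> s) (Suc s) \<bullet> \<rho> (Suc s)"
    using assms lin_ext_split_top[of "\<rho> s" s \<rho>] by (simp add: twist_rows_def lower_part_def algebra_simps)
  then show ?thesis
    by (simp add: scale.scale_left_diff_distrib diff_eq_eq)
qed

text \<open>
  The top coefficients are forced before the rows are known to be unique; this is what shows that
  the factor \<open>1 - m\<^sub>s\<close> in front of \<open>\<rho> (Suc s)\<close> is invertible.
\<close>

lemma top_twist_rows:
  assumes "\<And>n. Q n b c \<noteq> 0" and \<rho>: "twist_rows b c \<rho>"
  shows "Poly_Mapping.lookup (\<rho> s) (Suc s) = c * P s b c / Q s b c"
proof (induction s)
  case 0
  show ?case using \<rho> by (simp add: twist_rows_def lookup_one)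
next
  case (Suc s)
  have "(1 - c * P s b c / Q s b c) * Poly_Mapping.lookup (\<rho> (Suc s)) (Suc (Suc s)) = b * (c * P s b c / Q s b c) + c"
    using arg_cong[OF twist_rows_Suc[OF \<rho>, of s], of "\<lambda>u. Poly_Mapping.lookup u (Suc (Suc s))"]
    using \<rho> by (simp add: Suc lookup_lower_part twist_rows_def)
  then show ?case
    using assms(1)[of s] assms(1)[of "Suc s"] by (simp add: field_simps)
qed

lemma one_minus_top:
  fixes b c :: "'k::field"
  assumes "\<And>n. Q n b c \<noteq> 0"
  shows "1 - c * P s b c / Q s b c = Q (Suc s) b c / Q s b c"
  using assms[of s] by (simp add: field_simps)

text \<open>
  Since \<open>1 - m\<^sub>s = Q\<^sub>s\<^sub>+\<^sub>1 / Q\<^sub>s\<close> is invertible, the implicit recursion and its solved form \<open>row\<close> are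
  equivalent. This gives both existence and uniqueness of the rows.
\<close>

lemma twist_rows_iff:
  assumes Q: "\<And>n. Q n b c \<noteq> 0"
  shows "twist_rows b c \<rho> \<longleftrightarrow> \<rho> = row b c"
proof
  assume \<rho>: "twist_rows b c \<rho>"
  have "\<rho> s = row b c s" for s
  proof (induction s rule: less_induct)
    case (less s)
    show ?case
    proof (cases s)
      case 0
      then show ?thesis using \<rho> by (simp add: twist_rows_def)
    next
      case (Suc n)
      have "(Q (Suc n) b c / Q n b c) \<bullet> \<rho> s = lower_part b c \<rho> n"
        using twist_rows_Suc[OF \<rho>, of n] by (simp add: top_twist_rows[OF Q \<rho>] one_minus_top[OF Q] Suc)
      also have "lower_part b c \<rho> n = lower_part b c (row b c) n"
        by (simp add: lower_part_def less Suc)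
      finally have "(Q n b c / Q (Suc n) b c) \<bullet> (Q (Suc n) b c / Q n b c) \<bullet> \<rho> s = row b c s"
        by (simp add: row_Suc Suc)
      then show ?thesis
        using Q[of n] Q[of "Suc n"] by (simp del: Q.simps)
    qed
  qed
  then show "\<rho> = row b c" by blast
next
  assume \<rho>: "\<rho> = row b c"
  have "row b c (Suc s) = lin_ext (row b c) (row b c s) + b \<bullet> (Y * row b c s) + c \<bullet> bvec (s + 2)" for s
  proof -
    let ?m = "Poly_Mapping.lookup (row b c s) (Suc s)"
    have "(1 - ?m) \<bullet> row b c (Suc s) = lower_part b c (row b c) s"
      using Q[of s] Q[of "Suc s"]
      unfolding top_row[OF Q] one_minus_top[OF Q] row_Suc by (simp del: Q.simps)
    then have "row b c (Suc s) = lower_part b c (row b c) s + ?m \<bullet> row b c (Suc s)"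
      by (simp add: scale.scale_left_diff_distrib algebra_simps)
    also have "\<dots> = lin_ext (row b c) (row b c s) + b \<bullet> (Y * row b c s) + c \<bullet> bvec (s + 2)"
      by (simp add: lin_ext_split_top[OF keys_row] lower_part_def)
    finally show ?thesis .
  qed
  then show "twist_rows b c \<rho>"
    by (simp add: twist_rows_def \<rho> keys_row)
qed


section \<open>Commuting the operator past powers of the indeterminate\<close>

text \<open>
  The element \<open>\<Sum>\<^sub>l v\<^sub>l x\<^sup>n\<^sup>-\<^sup>l y\<^sup>l\<close>, whose value at \<open>x = 1\<close> is \<open>v\<close>, acts on \<open>u\<close>: first \<open>x\<close> acts
  through \<open>M\<close>, then \<open>y\<close> by multiplication. It is the right action of the twisted product on \<open>K[y]\<close>,
  and for this reason the order of the factors is reversed when it is written with operators on the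
  left. Only \<open>v\<close> of degree at most \<open>n\<close> is meaningful, because \<open>n - l\<close> is a truncated difference.
\<close>

definition ordered_action :: "('k::field upoly \<Rightarrow> 'k upoly) \<Rightarrow> nat \<Rightarrow> 'k upoly \<Rightarrow> 'k upoly \<Rightarrow> 'k upoly"
  where "ordered_action M n v u = lin_ext (\<lambda>l. bvec l * (M ^^ (n - l)) u) v"

lemma klinear_funpow:
  fixes M :: "('i \<Rightarrow>\<^sub>0 'k::field) \<Rightarrow> ('i \<Rightarrow>\<^sub>0 'k)"
  shows "klinear M \<Longrightarrow> klinear (M ^^ k)"
  by (induction k) (auto intro!: klinearI simp: klinear_add klinear_scale)

lemma ordered_action_funpow:
  assumes "Poly_Mapping.keys v \<subseteq> {..n}"
  shows "ordered_action M n v ((M ^^ k) u) = ordered_action M (n + k) v u"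
  unfolding ordered_action_def
proof (rule lin_ext_cong)
  fix l assume "l \<in> Poly_Mapping.keys v"
  then have "n + k - l = (n - l) + k" using assms by auto
  then show "bvec l * (M ^^ (n - l)) ((M ^^ k) u) = bvec l * (M ^^ (n + k - l)) u"
    by (simp add: funpow_add)
qed

lemma ordered_action_Y_mult: "ordered_action M (Suc n) (Y * v) u = Y * ordered_action M n v u"
  by (simp add: ordered_action_def klinear_of_lin_ext Y_mult_eq[of v])
    (simp add: Y_mult_bvec flip: mult.assoc)

lemma twist_rows_relation:
  assumes "twist_rows b c \<rho>"
  shows "lin_ext \<rho> (Y * u) = lin_ext \<rho> (lin_ext \<rho> u) + b \<bullet> (Y * lin_ext \<rho> u) + c \<bullet> (Y * (Y * u))"
    (is "?L u = ?R u")
proof -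
  have "?L = ?R"
  proof (rule klinear_eqI)
    show "klinear ?L" "klinear ?R"
      by (auto intro!: klinearI simp: scale_mult_right algebra_simps scale.scale_right_distrib mult.commute)
    show "?L (bvec s) = ?R (bvec s)" for s
      using assms by (simp add: Y_mult_bvec twist_rows_def)
  qed
  then show ?thesis by metis
qed

lemma keys_twist_funpow:
  assumes "twist_rows b c \<rho>" "Poly_Mapping.keys u \<subseteq> {..n}"
  shows "Poly_Mapping.keys ((lin_ext \<rho> ^^ k) u) \<subseteq> {..n + k}"
proof (induction k)
  case 0
  show ?case using assms(2) by simp
next
  case (Suc k)
  have "Poly_Mapping.keys (\<rho> i) \<subseteq> {..n + Suc k}" if "i \<in> Poly_Mapping.keys ((lin_ext \<rho> ^^ k) u)" for i
    using assms(1) Suc that by (force simp: twist_rows_def)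
  then show ?case by (simp add: keys_lin_ext)
qed

text \<open>
  Multiplying by \<open>y\<^sup>s\<close> and then applying \<open>M\<close> equals the action of \<open>y\<^sup>s x\<close> rewritten in the order
  \<open>x, y\<close>, that is, of \<open>\<tau>(y\<^sup>s \<otimes> x)\<close>. In the step from \<open>t\<close> to \<open>s = t + 1\<close>, the relation for
  \<open>M (y \<cdot> y\<^sup>t u)\<close> and the induction hypothesis for the exponents \<open>l \<le> t\<close> reduce everything to the rows
  up to \<open>t\<close>, apart from the term with \<open>l = s\<close>, which is \<open>m\<^sub>t\<close> times the unknown \<open>M (y\<^sup>s u)\<close>. The rows
  obey the same equation, so the claim follows after cancelling \<open>1 - m\<^sub>t\<close>.
\<close>

lemma twist_mult_bvec:
  assumes Q: "\<And>n. Q n b c \<noteq> 0" and \<rho>: "twist_rows b c \<rho>"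
  shows "lin_ext \<rho> (bvec s * u) = ordered_action (lin_ext \<rho>) (Suc s) (\<rho> s) u"
proof (induction s arbitrary: u rule: less_induct)
  case (less s)
  let ?M = "lin_ext \<rho>"
  show ?case
  proof (cases s)
    case 0
    have "\<rho> 0 = bvec 0" using \<rho> by (simp add: twist_rows_def)
    then show ?thesis by (simp only: 0 ordered_action_def lin_ext_bvec) simp
  next
    case (Suc t)
    define m where "m = Poly_Mapping.lookup (\<rho> t) (Suc t)"
    have keys: "Poly_Mapping.keys (\<rho> j) \<subseteq> {..Suc j}" for j
      using \<rho> by (simp add: twist_rows_def)
    \<comment> \<open>The induction hypothesis is used at \<open>M\<^sup>t\<^sup>+\<^sup>1\<^sup>-\<^sup>l u\<close>, which brings all terms to the same degree.\<close>
    have inner: "?M (bvec l * (?M ^^ (Suc t - l)) u) = ordered_action ?M (Suc s) (\<rho> l) u" if "l \<le> t" for l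
    proof -
      have "l < s" using that Suc by simp
      from less[OF this] have "?M (bvec l * (?M ^^ (Suc t - l)) u) =
          ordered_action ?M (Suc l) (\<rho> l) ((?M ^^ (Suc t - l)) u)" .
      also have "\<dots> = ordered_action ?M (Suc l + (Suc t - l)) (\<rho> l) u"
        by (rule ordered_action_funpow[OF keys])
      finally show ?thesis using that Suc by simp
    qed
    have "t < s" using Suc by simp
    note IH = less[OF this, of u]
    have "?M (?M (bvec t * u)) = lin_ext (\<lambda>l. ?M (bvec l * (?M ^^ (Suc t - l)) u)) (\<rho> t)"
      unfolding IH by (simp add: ordered_action_def klinear_of_lin_ext)
    also have "\<dots> = (\<Sum>j\<le>t. Poly_Mapping.lookup (\<rho> t) j \<bullet> ordered_action ?M (Suc s) (\<rho> j) u) + m \<bullet> ?M (bvec s * u)"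
      unfolding lin_ext_split_top[OF keys] by (simp add: inner m_def Suc)
    also have "(\<Sum>j\<le>t. Poly_Mapping.lookup (\<rho> t) j \<bullet> ordered_action ?M (Suc s) (\<rho> j) u) =
        ordered_action ?M (Suc s) (\<Sum>j\<le>t. Poly_Mapping.lookup (\<rho> t) j \<bullet> \<rho> j) u"
      by (simp add: ordered_action_def klinear_sum[OF klinear_lin_ext])
    finally have MM: "?M (?M (bvec t * u)) =
        ordered_action ?M (Suc s) (\<Sum>j\<le>t. Poly_Mapping.lookup (\<rho> t) j \<bullet> \<rho> j) u + m \<bullet> ?M (bvec s * u)" .
    have top: "Y * (Y * (bvec t * u)) = ordered_action ?M (Suc s) (bvec (t + 2)) u"
      by (simp add: ordered_action_def Suc Y_mult_bvec flip: mult.assoc)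
    have "bvec s * u = Y * (bvec t * u)"
      by (simp add: Suc Y_mult_bvec flip: mult.assoc)
    then have "?M (bvec s * u) = ?M (?M (bvec t * u)) + b \<bullet> (Y * ?M (bvec t * u)) + c \<bullet> (Y * (Y * (bvec t * u)))"
      by (simp only: twist_rows_relation[OF \<rho>])
    also have "\<dots> = ordered_action ?M (Suc s) (lower_part b c \<rho> t) u + m \<bullet> ?M (bvec s * u)"
      unfolding MM unfolding IH top ordered_action_Y_mult[symmetric] by (simp add: Suc lower_part_def ordered_action_def)
    also have "lower_part b c \<rho> t = (1 - m) \<bullet> \<rho> s"
      using twist_rows_Suc[OF \<rho>, of t] by (simp add: m_def Suc)
    finally have "(1 - m) \<bullet> ?M (bvec s * u) = (1 - m) \<bullet> ordered_action ?M (Suc s) (\<rho> s) u"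
      by (simp add: ordered_action_def scale.scale_left_diff_distrib[of 1 m "?M (bvec s * u)"] diff_eq_eq)
    moreover have "1 - m \<noteq> 0"
      unfolding m_def top_twist_rows[OF Q \<rho>] one_minus_top[OF Q] using Q[of t] Q[of "Suc t"] by simp
    ultimately show ?thesis by (metis scale.scale_left_imp_eq scale.scale_cancel_left)
  qed
qed

lemma twist_funpow_mult_bvec:
  assumes Q: "\<And>n. Q n b c \<noteq> 0" and \<rho>: "twist_rows b c \<rho>"
  shows "(lin_ext \<rho> ^^ k) (bvec s * u) = ordered_action (lin_ext \<rho>) (s + k) ((lin_ext \<rho> ^^ k) (bvec s)) u"
proof (induction k)
  case 0
  show ?case by (simp add: ordered_action_def)
next
  case (Suc k)
  let ?M = "lin_ext \<rho>"
  let ?w = "(?M ^^ k) (bvec s)"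
  have keys: "Poly_Mapping.keys (\<rho> j) \<subseteq> {..Suc j}" for j
    using \<rho> by (simp add: twist_rows_def)
  have w: "Poly_Mapping.keys ?w \<subseteq> {..s + k}"
    by (rule keys_twist_funpow[OF \<rho>]) simp
  have "(?M ^^ Suc k) (bvec s * u) = lin_ext (\<lambda>l. ?M (bvec l * (?M ^^ (s + k - l)) u)) ?w"
    by (simp add: Suc) (simp add: ordered_action_def klinear_of_lin_ext)
  also have "\<dots> = lin_ext (\<lambda>l. ordered_action ?M (s + Suc k) (\<rho> l) u) ?w"
  proof (rule lin_ext_cong)
    fix l assume "l \<in> Poly_Mapping.keys ?w"
    then have "l \<le> s + k" using w by auto
    then show "?M (bvec l * (?M ^^ (s + k - l)) u) = ordered_action ?M (s + Suc k) (\<rho> l) u"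
      by (simp add: twist_mult_bvec[OF Q \<rho>] ordered_action_funpow[OF keys])
  qed
  also have "\<dots> = ordered_action ?M (s + Suc k) (lin_ext \<rho> ?w) u"
    by (simp add: ordered_action_def klinear_of_lin_ext)
  finally show ?case by simp
qed


section \<open>Twisting maps on the monomial basis\<close>

lemma bvec_pair: "bvec (i, j) = bvec i \<otimes> (bvec j :: 'j \<Rightarrow>\<^sub>0 'k::field)"
  by (simp add: tensor_single)

lemma klinear_mu [simp]: "klinear mu"
  by (simp add: mu_def klinear_tensor_lift)

lemma klinear_assoc_l [simp]: "klinear assoc_l"
  by (simp add: assoc_l_def klinear_tensor_lift)

lemma klinear_assoc_r [simp]: "klinear assoc_r"
  by (simp add: assoc_r_def klinear_tensor_lift)

lemma klinear_tensor_map [simp]: "klinear (f \<otimes>\<^sub>m g)"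
  by (simp add: tensor_map_def klinear_tensor_lift)

lemma klinear_id [simp]: "klinear id"
  by (simp add: klinearI)

lemma klinear_comp: "klinear f \<Longrightarrow> klinear g \<Longrightarrow> klinear (f \<circ> g)"
  by (simp add: o_def klinear_compose)

lemma klinear_tensor_left: "klinear (\<lambda>u. u \<otimes> v)" and klinear_tensor_right: "klinear (\<lambda>v. u \<otimes> v)"
  using kbilinear_tensor by (auto simp: kbilinear_def)

definition xshift :: "nat \<Rightarrow> (nat \<times> nat \<Rightarrow>\<^sub>0 'k::field) \<Rightarrow> (nat \<times> nat \<Rightarrow>\<^sub>0 'k)"
  where "xshift p = lin_ext (\<lambda>(q, l). bvec (p + q, l))"

definition yshift :: "nat \<Rightarrow> (nat \<times> nat \<Rightarrow>\<^sub>0 'k::field) \<Rightarrow> (nat \<times> nat \<Rightarrow>\<^sub>0 'k)"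
  where "yshift l = lin_ext (\<lambda>(q, j). bvec (q, j + l))"

lemma xshift_bvec: "xshift p (bvec (q, l)) = bvec (p + q, l)"
  by (simp add: xshift_def)

lemma yshift_bvec: "yshift l (bvec (q, j)) = bvec (q, j + l)"
  by (simp add: yshift_def)

text \<open>
  In the composites that define a twisting map, a multiplication is preceded by a
  reassociation, and one of the two tensor legs involved is a monomial.
\<close>

lemma mu_left_bvec: "(mu \<otimes>\<^sub>m id) (assoc_l (bvec p \<otimes> w)) = xshift p w"
proof -
  have "(\<lambda>w. (mu \<otimes>\<^sub>m id) (assoc_l (bvec p \<otimes> w))) = xshift p"
  proof (rule klinear_eqI)
    show "klinear (\<lambda>w. (mu \<otimes>\<^sub>m id) (assoc_l (bvec p \<otimes> w)))"
      by (intro klinear_compose[OF klinear_tensor_map] klinear_compose[OF klinear_assoc_l]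
          klinear_tensor_right)
    show "klinear (xshift p)" by (simp add: xshift_def)
    show "(mu \<otimes>\<^sub>m id) (assoc_l (bvec p \<otimes> bvec q)) = xshift p (bvec q)" for q
      by (cases q) (simp add: bvec_pair assoc_l_tensor tensor_map_tensor mu_tensor bvec_mult_bvec
          xshift_bvec[unfolded bvec_pair])
  qed
  then show ?thesis by metis
qed

lemma mu_right_bvec: "(id \<otimes>\<^sub>m mu) (assoc_r (w \<otimes> bvec l)) = yshift l w"
proof -
  have "(\<lambda>w. (id \<otimes>\<^sub>m mu) (assoc_r (w \<otimes> bvec l))) = yshift l"
  proof (rule klinear_eqI)
    show "klinear (\<lambda>w. (id \<otimes>\<^sub>m mu) (assoc_r (w \<otimes> bvec l)))"
      by (intro klinear_compose[OF klinear_tensor_map] klinear_compose[OF klinear_assoc_r]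
          klinear_tensor_left)
    show "klinear (yshift l)" by (simp add: yshift_def)
    show "(id \<otimes>\<^sub>m mu) (assoc_r (bvec q \<otimes> bvec l)) = yshift l (bvec q)" for q
      by (cases q) (simp add: bvec_pair assoc_r_tensor tensor_map_tensor mu_tensor bvec_mult_bvec
          yshift_bvec[unfolded bvec_pair])
  qed
  then show ?thesis by metis
qed

text \<open>
  The right-hand sides of the two compatibility conditions at a basis tensor. In both, all maps but
  the first application of \<open>\<tau>\<close> combine to a linear map \<open>F\<close>, so it suffices to know \<open>F\<close> on monomials.
\<close>

lemma twist_x_rhs:
  assumes "klinear \<tau>"
  shows "((mu \<otimes>\<^sub>m id) \<circ> assoc_l \<circ> (id \<otimes>\<^sub>m \<tau>) \<circ> assoc_r \<circ> (\<tau> \<otimes>\<^sub>m id) \<circ> assoc_l) (bvec (r, i, k)) =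
    lin_ext (\<lambda>(p, l). xshift p (\<tau> (bvec (l, k)))) (\<tau> (bvec (r, i)))"
proof -
  define F where "F = (\<lambda>w. (mu \<otimes>\<^sub>m id) (assoc_l ((id \<otimes>\<^sub>m \<tau>) (assoc_r (w \<otimes> bvec k)))))"
  have F: "klinear F"
    unfolding F_def by (intro klinear_compose[OF klinear_tensor_map] klinear_compose[OF klinear_assoc_l]
        klinear_compose[OF klinear_assoc_r] klinear_tensor_left)
  have pl: "F (bvec pl) = (\<lambda>(p, l). xshift p (\<tau> (bvec (l, k)))) pl" for pl
    using assms
    by (cases pl) (simp add: F_def bvec_pair assoc_r_tensor tensor_map_tensor mu_left_bvec)
  have "((mu \<otimes>\<^sub>m id) \<circ> assoc_l \<circ> (id \<otimes>\<^sub>m \<tau>) \<circ> assoc_r \<circ> (\<tau> \<otimes>\<^sub>m id) \<circ> assoc_l) (bvec (r, i, k)) =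
      F (\<tau> (bvec (r, i)))"
    using assms by (simp add: F_def bvec_pair assoc_l_tensor tensor_map_tensor)
  then show ?thesis
    using klinear_eq_lin_ext[OF F, of "\<tau> (bvec (r, i))"] by (simp add: pl)
qed

lemma twist_y_rhs:
  assumes "klinear \<tau>"
  shows "((id \<otimes>\<^sub>m mu) \<circ> assoc_r \<circ> (\<tau> \<otimes>\<^sub>m id) \<circ> assoc_l \<circ> (id \<otimes>\<^sub>m \<tau>) \<circ> assoc_r) (bvec ((r, s), k)) =
    lin_ext (\<lambda>(p, l). yshift l (\<tau> (bvec (r, p)))) (\<tau> (bvec (s, k)))"
proof -
  define F where "F = (\<lambda>w. (id \<otimes>\<^sub>m mu) (assoc_r ((\<tau> \<otimes>\<^sub>m id) (assoc_l (bvec r \<otimes> w)))))"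
  have F: "klinear F"
    unfolding F_def by (intro klinear_compose[OF klinear_tensor_map] klinear_compose[OF klinear_assoc_l]
        klinear_compose[OF klinear_assoc_r] klinear_tensor_right)
  have pl: "F (bvec pl) = (\<lambda>(p, l). yshift l (\<tau> (bvec (r, p)))) pl" for pl
    using assms
    by (cases pl) (simp add: F_def bvec_pair assoc_l_tensor tensor_map_tensor mu_right_bvec)
  have "((id \<otimes>\<^sub>m mu) \<circ> assoc_r \<circ> (\<tau> \<otimes>\<^sub>m id) \<circ> assoc_l \<circ> (id \<otimes>\<^sub>m \<tau>) \<circ> assoc_r) (bvec ((r, s), k)) =
      F (\<tau> (bvec (s, k)))"
    using assms by (simp add: F_def bvec_pair assoc_r_tensor tensor_map_tensor)
  then show ?thesis
    using klinear_eq_lin_ext[OF F, of "\<tau> (bvec (s, k))"] by (simp add: pl)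
qed

lemma klinear_eq_iff:
  "klinear f \<Longrightarrow> klinear g \<Longrightarrow> f = g \<longleftrightarrow> (\<forall>i. f (bvec i) = g (bvec i))"
  using klinear_eqI by blast

lemma twisting_map_iff:
  "twisting_map \<tau> \<longleftrightarrow> klinear \<tau> \<and>
    (\<forall>i. \<tau> (bvec (0, i)) = bvec (i, 0)) \<and>
    (\<forall>r. \<tau> (bvec (r, 0)) = bvec (0, r)) \<and>
    (\<forall>r i k. \<tau> (bvec (r, i + k)) = lin_ext (\<lambda>(p, l). xshift p (\<tau> (bvec (l, k)))) (\<tau> (bvec (r, i)))) \<and>
    (\<forall>r s k. \<tau> (bvec (r + s, k)) = lin_ext (\<lambda>(p, l). yshift l (\<tau> (bvec (r, p)))) (\<tau> (bvec (s, k))))"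
proof (cases "klinear \<tau>")
  case True
  have "(\<lambda>f. \<tau> (1 \<otimes> f)) = (\<lambda>f. f \<otimes> 1) \<longleftrightarrow> (\<forall>i. \<tau> (1 \<otimes> bvec i) = bvec i \<otimes> 1)"
    by (rule klinear_eq_iff[OF klinear_compose[OF True klinear_tensor_right] klinear_tensor_left])
  then have 1: "(\<forall>f. \<tau> (1 \<otimes> f) = f \<otimes> 1) \<longleftrightarrow> (\<forall>i. \<tau> (bvec (0, i)) = bvec (i, 0))"
    by (simp add: fun_eq_iff bvec_pair)
  have 2: "(\<forall>r. \<tau> (Y ^ r \<otimes> 1) = 1 \<otimes> Y ^ r) \<longleftrightarrow> (\<forall>r. \<tau> (bvec (r, 0)) = bvec (0, r))"
    by (simp add: Y_power bvec_pair)
  have 3: "\<tau> \<circ> (id \<otimes>\<^sub>m mu) = (mu \<otimes>\<^sub>m id) \<circ> assoc_l \<circ> (id \<otimes>\<^sub>m \<tau>) \<circ> assoc_r \<circ> (\<tau> \<otimes>\<^sub>m id) \<circ> assoc_l \<longleftrightarrow>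
    (\<forall>r i k. \<tau> (bvec (r, i + k)) = lin_ext (\<lambda>(p, l). xshift p (\<tau> (bvec (l, k)))) (\<tau> (bvec (r, i))))"
  proof (subst klinear_eq_iff)
    have "(\<tau> \<circ> (id \<otimes>\<^sub>m mu)) (bvec (r, i, k)) = \<tau> (bvec (r, i + k))" for r i k
      by (simp add: bvec_pair tensor_map_tensor mu_tensor bvec_mult_bvec)
    then show "(\<forall>x. (\<tau> \<circ> (id \<otimes>\<^sub>m mu)) (bvec x) =
        ((mu \<otimes>\<^sub>m id) \<circ> assoc_l \<circ> (id \<otimes>\<^sub>m \<tau>) \<circ> assoc_r \<circ> (\<tau> \<otimes>\<^sub>m id) \<circ> assoc_l) (bvec x)) \<longleftrightarrow>
        (\<forall>r i k. \<tau> (bvec (r, i + k)) = lin_ext (\<lambda>(p, l). xshift p (\<tau> (bvec (l, k)))) (\<tau> (bvec (r, i))))"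
      by (simp only: split_paired_All twist_x_rhs[OF True])
  qed (intro klinear_comp True klinear_tensor_map klinear_assoc_l klinear_assoc_r)+
  have 4: "\<tau> \<circ> (mu \<otimes>\<^sub>m id) = (id \<otimes>\<^sub>m mu) \<circ> assoc_r \<circ> (\<tau> \<otimes>\<^sub>m id) \<circ> assoc_l \<circ> (id \<otimes>\<^sub>m \<tau>) \<circ> assoc_r \<longleftrightarrow>
    (\<forall>r s k. \<tau> (bvec (r + s, k)) = lin_ext (\<lambda>(p, l). yshift l (\<tau> (bvec (r, p)))) (\<tau> (bvec (s, k))))"
  proof (subst klinear_eq_iff)
    have "(\<tau> \<circ> (mu \<otimes>\<^sub>m id)) (bvec ((r, s), k)) = \<tau> (bvec (r + s, k))" for r s k
      by (simp add: bvec_pair tensor_map_tensor mu_tensor bvec_mult_bvec)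
    then show "(\<forall>x. (\<tau> \<circ> (mu \<otimes>\<^sub>m id)) (bvec x) =
        ((id \<otimes>\<^sub>m mu) \<circ> assoc_r \<circ> (\<tau> \<otimes>\<^sub>m id) \<circ> assoc_l \<circ> (id \<otimes>\<^sub>m \<tau>) \<circ> assoc_r) (bvec x)) \<longleftrightarrow>
        (\<forall>r s k. \<tau> (bvec (r + s, k)) = lin_ext (\<lambda>(p, l). yshift l (\<tau> (bvec (r, p)))) (\<tau> (bvec (s, k))))"
      by (simp only: split_paired_All twist_y_rhs[OF True])
  qed (intro klinear_comp True klinear_tensor_map klinear_assoc_l klinear_assoc_r)+
  show ?thesis
    unfolding twisting_map_def 1 2 3 4 ..
qed (simp add: twisting_map_def)

section \<open>Homogeneous elements\<close>

definition homogeneous :: "nat \<Rightarrow> (nat \<times> nat \<Rightarrow>\<^sub>0 'k::field) \<Rightarrow> bool"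
  where "homogeneous n w \<longleftrightarrow> Poly_Mapping.keys w \<subseteq> {(p, l). p + l = n}"

text \<open>
  Setting \<open>x = 1\<close>, and the inverse operation on homogeneous elements of degree \<open>n\<close>: each \<open>y\<^sup>l\<close> is
  filled up with a power of \<open>x\<close>.
\<close>

definition dehom :: "(nat \<times> nat \<Rightarrow>\<^sub>0 'k::field) \<Rightarrow> 'k upoly"
  where "dehom = lin_ext (\<lambda>(p, l). bvec l)"

definition hom :: "nat \<Rightarrow> 'k::field upoly \<Rightarrow> (nat \<times> nat \<Rightarrow>\<^sub>0 'k)"
  where "hom n = lin_ext (\<lambda>l. bvec (n - l, l))"

lemma graded_map_iff:
  fixes \<tau> :: "(nat \<times> nat \<Rightarrow>\<^sub>0 'k::field) \<Rightarrow> (nat \<times> nat \<Rightarrow>\<^sub>0 'k)"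
  shows "graded_map \<tau> \<longleftrightarrow> (\<forall>r i. homogeneous (r + i) (\<tau> (bvec (r, i))))"
proof -
  have "w \<in> scale.span {X ^ (n - j) \<otimes> Y ^ j | j. j \<le> n} \<longleftrightarrow> homogeneous n w" (is "w \<in> scale.span ?B \<longleftrightarrow> _")
    for n and w :: "nat \<times> nat \<Rightarrow>\<^sub>0 'k"
  proof
    have "scale.span ?B \<subseteq> {w. homogeneous n w}"
    proof (rule scale.span_minimal)
      show "?B \<subseteq> {w. homogeneous n w}"
        by (auto simp: homogeneous_def X_power Y_power tensor_single)
      show "scale.subspace {w :: nat \<times> nat \<Rightarrow>\<^sub>0 'k. homogeneous n w}"
        unfolding scale.subspace_def homogeneous_def
        using Poly_Mapping.keys_add keys_scale by fastforce
    qed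
    then show "w \<in> scale.span ?B \<Longrightarrow> homogeneous n w" by blast
  next
    assume w: "homogeneous n w"
    have "Poly_Mapping.lookup w q \<bullet> bvec q \<in> scale.span ?B" if q_key: "q \<in> Poly_Mapping.keys w" for q
    proof -
      obtain p l where q: "q = (p, l)" "p + l = n"
        using w q_key by (cases q) (auto simp: homogeneous_def)
      then have "(bvec q :: nat \<times> nat \<Rightarrow>\<^sub>0 'k) = X ^ (n - l) \<otimes> Y ^ l" "l \<le> n"
        by (auto simp: X_power Y_power tensor_single)
      then show ?thesis
        by (intro scale.span_scale scale.span_base) blast
    qed
    then show "w \<in> scale.span ?B"
      by (subst basis_expansion[OF finite_keys subset_refl, of w]) (rule scale.span_sum)
  qed
  then show ?thesis
    by (simp add: graded_map_def X_power Y_power tensor_single)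
qed

lemma homogeneous_bvec [simp]: "homogeneous n (bvec (p, l)) \<longleftrightarrow> p + l = n"
  by (auto simp: homogeneous_def)

lemma homogeneous_lin_ext:
  "(\<And>i. i \<in> Poly_Mapping.keys u \<Longrightarrow> homogeneous n (g i)) \<Longrightarrow> homogeneous n (lin_ext g u)"
  unfolding homogeneous_def by (rule keys_lin_ext)

lemma homogeneous_hom: "Poly_Mapping.keys u \<subseteq> {..n} \<Longrightarrow> homogeneous n (hom n u)"
  unfolding hom_def by (rule homogeneous_lin_ext) auto

lemma homogeneous_xshift: "homogeneous n w \<Longrightarrow> homogeneous (p + n) (xshift p w)"
  unfolding xshift_def by (rule homogeneous_lin_ext) (auto simp: homogeneous_def)

lemma homogeneous_yshift: "homogeneous n w \<Longrightarrow> homogeneous (n + l) (yshift l w)"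
  unfolding yshift_def by (rule homogeneous_lin_ext) (auto simp: homogeneous_def)

lemma keys_dehom: "homogeneous n w \<Longrightarrow> Poly_Mapping.keys (dehom w) \<subseteq> {..n}"
  unfolding dehom_def by (rule keys_lin_ext) (auto simp: homogeneous_def)

text \<open>
  With \<open>homogeneous_eqI\<close> below this reduces every identity between homogeneous elements of \<open>K[x] \<otimes> K[y]\<close>
  to one between polynomials in \<open>y\<close>.
\<close>

lemma hom_dehom:
  assumes "homogeneous n w"
  shows "hom n (dehom w) = w"
proof -
  have "hom n (dehom w) = lin_ext bvec w"
    using assms unfolding hom_def dehom_def klinear_of_lin_ext[OF klinear_lin_ext]
    by (intro lin_ext_cong) (auto simp: homogeneous_def)
  also have "\<dots> = w"
    using klinear_eq_lin_ext[OF klinear_id, of w] by simp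
  finally show ?thesis .
qed

lemma dehom_hom: "dehom (hom n u) = u"
  using klinear_eq_lin_ext[OF klinear_id, of u]
  by (simp add: hom_def dehom_def klinear_of_lin_ext)

lemma homogeneous_eqI: "homogeneous n v \<Longrightarrow> homogeneous n w \<Longrightarrow> dehom v = dehom w \<Longrightarrow> v = w"
  by (metis hom_dehom)

lemma klinear_dehom [simp]: "klinear dehom"
  by (simp add: dehom_def)

lemma dehom_add [simp]: "dehom (v + w) = dehom v + dehom w"
  by (simp add: dehom_def)

lemma dehom_scale [simp]: "dehom (a \<bullet> w) = a \<bullet> dehom w"
  by (simp add: dehom_def)

lemma dehom_bvec [simp]: "dehom (bvec (p, l)) = bvec l"
  by (simp add: dehom_def)

lemma lin_ext_dehom: "lin_ext g (dehom w) = lin_ext (\<lambda>(p, l). g l) w"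
  by (simp add: dehom_def klinear_of_lin_ext case_prod_unfold)

lemma dehom_xshift [simp]: "dehom (xshift p w) = dehom w"
  unfolding xshift_def klinear_of_lin_ext[OF klinear_dehom]
  by (simp add: dehom_def case_prod_unfold)

lemma dehom_yshift [simp]: "dehom (yshift l w) = bvec l * dehom w"
  unfolding yshift_def dehom_def klinear_of_lin_ext[OF klinear_lin_ext] klinear_of_lin_ext[OF klinear_mult]
  by (rule lin_ext_cong) (auto simp: bvec_mult_bvec add.commute)

section \<open>Graded twisting maps and sequences of rows\<close>

text \<open>
  At \<open>x = 1\<close>, the right-hand side of the first compatibility condition is a composition of operators
  on \<open>K[y]\<close>; hence \<open>x\<^sup>i\<close> corresponds to the \<open>i\<close>-th power of the operator of \<open>x\<close>.
\<close>

lemma dehom_twist_x: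
  "dehom (lin_ext (\<lambda>(p, l). xshift p (\<tau> (bvec (l, k)))) w) =
     lin_ext (\<lambda>l. dehom (\<tau> (bvec (l, k)))) (dehom w)"
  unfolding klinear_of_lin_ext[OF klinear_dehom] lin_ext_dehom
  by (rule lin_ext_cong) auto

definition row_twist :: "(nat \<Rightarrow> 'k upoly) \<Rightarrow> (nat \<times> nat \<Rightarrow>\<^sub>0 'k::field) \<Rightarrow> (nat \<times> nat \<Rightarrow>\<^sub>0 'k)"
  where "row_twist \<rho> = lin_ext (\<lambda>(r, i). hom (r + i) ((lin_ext \<rho> ^^ i) (bvec r)))"

lemma homogeneous_row_twist:
  assumes "twist_rows b c \<rho>"
  shows "homogeneous (r + i) (row_twist \<rho> (bvec (r, i)))"
  by (simp add: row_twist_def) (intro homogeneous_hom keys_twist_funpow[OF assms], simp)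

lemma dehom_row_twist: "dehom (row_twist \<rho> (bvec (r, i))) = (lin_ext \<rho> ^^ i) (bvec r)"
  by (simp add: row_twist_def dehom_hom)

text \<open>
  Both sides of each condition are homogeneous of the same degree, so they may be compared at \<open>x = 1\<close>.
  There the first condition is \<open>M\<^sup>i\<^sup>+\<^sup>k = M\<^sup>k \<circ> M\<^sup>i\<close>, and the second is \<open>twist_funpow_mult_bvec\<close> at
  \<open>u = y\<^sup>r\<close>.
\<close>

lemma twisting_row_twist:
  assumes Q: "\<And>n. Q n b c \<noteq> 0" and \<rho>: "twist_rows b c \<rho>"
  shows "twisting_map (row_twist \<rho>)"
  unfolding twisting_map_iff
proof (intro conjI allI)
  let ?M = "lin_ext \<rho>"
  let ?T = "row_twist \<rho>"
  note hT = homogeneous_row_twist[OF \<rho>]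
  have keysT: "p + l = r + i" if "(p, l) \<in> Poly_Mapping.keys (?T (bvec (r, i)))" for p l r i
    using that hT[of r i] by (auto simp: homogeneous_def)
  show "klinear ?T" by (simp add: row_twist_def)
  have "?M (bvec 0) = bvec 0" using \<rho> unfolding lin_ext_bvec by (simp add: twist_rows_def)
  then have "(?M ^^ i) (bvec 0) = bvec 0" for i by (induction i) auto
  then show "?T (bvec (0, i)) = bvec (i, 0)" for i
    by (intro homogeneous_eqI[of i]) (use hT[of 0] in \<open>auto simp: dehom_row_twist\<close>)
  show "?T (bvec (r, 0)) = bvec (0, r)" for r
    by (intro homogeneous_eqI[of r]) (use hT[of r 0] in \<open>auto simp: dehom_row_twist\<close>)
  show "?T (bvec (r, i + k)) = lin_ext (\<lambda>(p, l). xshift p (?T (bvec (l, k)))) (?T (bvec (r, i)))" (is "_ = ?R")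
    for r i k
  proof (rule homogeneous_eqI[OF hT])
    show "homogeneous (r + (i + k)) ?R"
    proof (rule homogeneous_lin_ext)
      fix q assume "q \<in> Poly_Mapping.keys (?T (bvec (r, i)))"
      then obtain p l where "q = (p, l)" "p + l = r + i" using keysT by (cases q) auto
      then show "homogeneous (r + (i + k)) (case q of (p, l) \<Rightarrow> xshift p (?T (bvec (l, k))))"
        using homogeneous_xshift[OF hT[of l k], of p] by (simp add: add.assoc[symmetric])
    qed
    have "(?M ^^ k) u = lin_ext (\<lambda>l. (?M ^^ k) (bvec l)) u" for u
      by (rule klinear_eq_lin_ext) (simp add: klinear_funpow)
    then show "dehom (?T (bvec (r, i + k))) = dehom ?R"
      unfolding dehom_twist_x dehom_row_twist by (metis add.commute comp_apply funpow_add)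
  qed
  show "?T (bvec (r + s, k)) = lin_ext (\<lambda>(p, l). yshift l (?T (bvec (r, p)))) (?T (bvec (s, k)))" (is "_ = ?R")
    for r s k
  proof (rule homogeneous_eqI[OF hT])
    show "homogeneous (r + s + k) ?R"
    proof (rule homogeneous_lin_ext)
      fix q assume "q \<in> Poly_Mapping.keys (?T (bvec (s, k)))"
      then obtain p l where "q = (p, l)" "p + l = s + k" using keysT by (cases q) auto
      then show "homogeneous (r + s + k) (case q of (p, l) \<Rightarrow> yshift l (?T (bvec (r, p))))"
        using homogeneous_yshift[OF hT[of r p], of l] by (simp add: add.assoc)
    qed
    have "dehom ?R = lin_ext (\<lambda>(p, l). bvec l * (?M ^^ p) (bvec r)) (?T (bvec (s, k)))"
      unfolding klinear_of_lin_ext[OF klinear_dehom]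
      by (rule lin_ext_cong) (auto simp: dehom_row_twist)
    \<comment> \<open>Homogeneity ties the exponent of \<open>x\<close> to that of \<open>y\<close>, so the former can be expressed by the latter.\<close>
    also have "\<dots> = lin_ext (\<lambda>(p, l). bvec l * (?M ^^ (s + k - l)) (bvec r)) (?T (bvec (s, k)))"
    proof (rule lin_ext_cong)
      fix q assume "q \<in> Poly_Mapping.keys (?T (bvec (s, k)))"
      then obtain p l where "q = (p, l)" "p = s + k - l" using keysT by (cases q) force
      then show "(case q of (p, l) \<Rightarrow> bvec l * (?M ^^ p) (bvec r)) =
          (case q of (p, l) \<Rightarrow> bvec l * (?M ^^ (s + k - l)) (bvec r))" by simp
    qed
    also have "\<dots> = ordered_action ?M (s + k) (dehom (?T (bvec (s, k)))) (bvec r)"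
      by (simp add: ordered_action_def lin_ext_dehom)
    also have "\<dots> = (?M ^^ k) (bvec (r + s))"
      unfolding dehom_row_twist twist_funpow_mult_bvec[OF Q \<rho>, symmetric]
      by (simp add: bvec_mult_bvec add.commute)
    finally show "dehom (?T (bvec (r + s, k))) = dehom ?R"
      by (simp add: dehom_row_twist)
  qed
qed

text \<open>
  Graded twisting maps are determined by their values at \<open>y\<^sup>r \<otimes> x\<close>, by induction on the exponent of
  \<open>x\<close> with the first compatibility condition.
\<close>

lemma graded_twisting_eq_row_twist:
  fixes \<tau> :: "(nat \<times> nat \<Rightarrow>\<^sub>0 'k::field) \<Rightarrow> (nat \<times> nat \<Rightarrow>\<^sub>0 'k)"
  assumes tw: "twisting_map \<tau>" and gr: "graded_map \<tau>"
  shows "\<tau> = row_twist (\<lambda>r. dehom (\<tau> (bvec (r, 1))))" (is "_ = row_twist ?\<rho>")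
proof (rule klinear_eqI)
  show "klinear \<tau>" using tw by (simp add: twisting_map_def)
  show "klinear (row_twist ?\<rho>)" by (simp add: row_twist_def)
  have h: "homogeneous (r + i) (\<tau> (bvec (r, i)))" for r i
    using gr by (simp add: graded_map_iff)
  have dehom: "dehom (\<tau> (bvec (r, i))) = (lin_ext ?\<rho> ^^ i) (bvec r)" for r i
  proof (induction i)
    case 0
    show ?case using tw by (simp add: twisting_map_iff)
  next
    case (Suc i)
    have "\<tau> (bvec (r, i + 1)) = lin_ext (\<lambda>(p, l). xshift p (\<tau> (bvec (l, 1)))) (\<tau> (bvec (r, i)))"
      using tw unfolding twisting_map_iff by blast
    then show ?case by (simp add: dehom_twist_x Suc)
  qed
  have "\<tau> (bvec (r, i)) = row_twist ?\<rho> (bvec (r, i))" for r i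
    using hom_dehom[OF h[of r i]] unfolding dehom[of r i] row_twist_def lin_ext_bvec by simp
  then show "\<tau> (bvec q) = row_twist ?\<rho> (bvec q)" for q
    by (cases q) blast
qed

text \<open>
  The second compatibility condition for \<open>y\<^sup>s \<cdot> y\<close> and \<open>x\<close> starts from \<open>\<tau>(y \<otimes> x)\<close>, whose three terms
  yield the three terms of the recursion; the first of them, \<open>\<tau>(y\<^sup>s \<otimes> x\<^sup>2)\<close>, becomes \<open>M(M y\<^sup>s)\<close>.
\<close>

lemma graded_twisting_rows:
  fixes \<tau> :: "(nat \<times> nat \<Rightarrow>\<^sub>0 'k::field) \<Rightarrow> (nat \<times> nat \<Rightarrow>\<^sub>0 'k)"
  assumes tw: "twisting_map \<tau>" and gr: "graded_map \<tau>"
    and val: "\<tau> (bvec (1, 1)) = bvec (2, 0) + b \<bullet> bvec (1, 1) + c \<bullet> bvec (0, 2)"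
  shows "twist_rows b c (\<lambda>r. dehom (\<tau> (bvec (r, 1))))" (is "twist_rows b c ?\<rho>")
  unfolding twist_rows_def
proof (intro conjI allI)
  have h: "homogeneous (r + i) (\<tau> (bvec (r, i)))" for r i
    using gr by (simp add: graded_map_iff)
  show "?\<rho> 0 = 1" using tw by (simp add: twisting_map_iff)
  show "Poly_Mapping.keys (?\<rho> s) \<subseteq> {..Suc s}" for s
    using keys_dehom[OF h[of s 1]] by simp
  show "?\<rho> (Suc s) = lin_ext ?\<rho> (?\<rho> s) + b \<bullet> (Y * ?\<rho> s) + c \<bullet> bvec (s + 2)" for s
  proof -
    have "\<tau> (bvec (s + 1, 1)) = lin_ext (\<lambda>(p, l). yshift l (\<tau> (bvec (s, p)))) (\<tau> (bvec (1, 1)))"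
      using tw unfolding twisting_map_iff by blast
    also have "\<dots> = yshift 0 (\<tau> (bvec (s, 2))) + b \<bullet> yshift 1 (\<tau> (bvec (s, 1))) + c \<bullet> yshift 2 (\<tau> (bvec (s, 0)))"
      unfolding val by simp
    finally have "?\<rho> (Suc s) = dehom (\<tau> (bvec (s, 2))) + b \<bullet> (Y * ?\<rho> s) + c \<bullet> (bvec 2 * dehom (\<tau> (bvec (s, 0))))"
      by (simp add: Y_def)
    moreover have "\<tau> (bvec (s, 1 + 1)) = lin_ext (\<lambda>(p, l). xshift p (\<tau> (bvec (l, 1)))) (\<tau> (bvec (s, 1)))"
      using tw unfolding twisting_map_iff by blast
    then have "dehom (\<tau> (bvec (s, 2))) = lin_ext ?\<rho> (?\<rho> s)"
      by (simp add: dehom_twist_x numeral_2_eq_2)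
    moreover have "\<tau> (bvec (s, 0)) = bvec (0, s)"
      using tw by (simp add: twisting_map_iff)
    ultimately show ?thesis by (simp add: bvec_mult_bvec)
  qed
qed

lemma row_twist_value:
  assumes "twist_rows b c \<rho>"
  shows "row_twist \<rho> (bvec (1, 1)) = bvec (2, 0) + b \<bullet> bvec (1, 1) + c \<bullet> bvec (0, 2)"
proof -
  have 0: "\<rho> 0 = bvec 0" using assms by (simp add: twist_rows_def)
  have "\<rho> (Suc 0) = lin_ext \<rho> (\<rho> 0) + b \<bullet> (Y * \<rho> 0) + c \<bullet> bvec (0 + 2)"
    using assms unfolding twist_rows_def by blast
  then have "\<rho> 1 = bvec 0 + b \<bullet> bvec 1 + c \<bullet> bvec 2"
    by (simp add: 0 Y_mult_bvec numeral_2_eq_2 del: single_one)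
  moreover have "row_twist \<rho> (bvec (1, 1)) = hom 2 (\<rho> 1)"
    by (simp add: row_twist_def numeral_2_eq_2)
  ultimately show ?thesis by (simp add: hom_def del: single_one)
qed

theorem theorem2p13:
  fixes b c :: "'k::field"
  assumes "c \<noteq> 1"
    and "\<And>n::nat. n \<ge> 1 \<Longrightarrow> Q n b c \<noteq> 0"
  shows "\<exists>!\<tau> :: (nat \<times> nat \<Rightarrow>\<^sub>0 'k) \<Rightarrow> (nat \<times> nat \<Rightarrow>\<^sub>0 'k).
    twisting_map \<tau> \<and> graded_map \<tau> \<and>
    \<tau> (Y \<otimes> X) = X ^ 2 \<otimes> 1 + b \<bullet> (X \<otimes> Y) + c \<bullet> (1 \<otimes> Y ^ 2)"
proof -
  have Q: "Q n b c \<noteq> 0" for n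
    using assms(2)[of n] by (cases n) auto
  have \<rho>: "twist_rows b c (row b c)"
    by (simp add: twist_rows_iff[OF Q])
  have val: "\<tau> (Y \<otimes> X) = X ^ 2 \<otimes> 1 + b \<bullet> (X \<otimes> Y) + c \<bullet> (1 \<otimes> Y ^ 2) \<longleftrightarrow>
      \<tau> (bvec (1, 1)) = bvec (2, 0) + b \<bullet> bvec (1, 1) + c \<bullet> bvec (0, 2)"
    for \<tau> :: "(nat \<times> nat \<Rightarrow>\<^sub>0 'k) \<Rightarrow> (nat \<times> nat \<Rightarrow>\<^sub>0 'k)"
    unfolding X_power Y_power by (simp add: X_def Y_def bvec_pair)
  show ?thesis
    unfolding val
  proof (rule ex1I[of _ "row_twist (row b c)"], intro conjI)
    show "twisting_map (row_twist (row b c))"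
      by (rule twisting_row_twist[OF Q \<rho>])
    show "graded_map (row_twist (row b c))"
      using homogeneous_row_twist[OF \<rho>] by (simp add: graded_map_iff)
    show "row_twist (row b c) (bvec (1, 1)) = bvec (2, 0) + b \<bullet> bvec (1, 1) + c \<bullet> bvec (0, 2)"
      by (rule row_twist_value[OF \<rho>])
  next
    fix \<tau> :: "(nat \<times> nat \<Rightarrow>\<^sub>0 'k) \<Rightarrow> (nat \<times> nat \<Rightarrow>\<^sub>0 'k)"
    assume \<tau>: "twisting_map \<tau> \<and> graded_map \<tau> \<and>
      \<tau> (bvec (1, 1)) = bvec (2, 0) + b \<bullet> bvec (1, 1) + c \<bullet> bvec (0, 2)"
    then have "\<tau> = row_twist (\<lambda>r. dehom (\<tau> (bvec (r, 1))))"
      using graded_twisting_eq_row_twist by blast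
    also have "(\<lambda>r. dehom (\<tau> (bvec (r, 1)))) = row b c"
      using \<tau> graded_twisting_rows twist_rows_iff[OF Q] by blast
    finally show "\<tau> = row_twist (row b c)" .
  qed
qed

end
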